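(* Let $A\subset\mathcal{R}$ be measurable. If $\lambda(m(A))=q$ and if $\{I_n\}_{n\in\mathbb{N}}$ is a sequence of pairwise disjoint intervals of $\mathcal{R}$ satisfying: (1) $\bigcup_{n\in\mathbb{N}}I_n\subseteq A$; (2) $\sum_{n\in\mathbb{N}}l(I_n)$ strongly converges; (3) $\lambda\left(m(A)-\sum_{n\in\mathbb{N}}l(I_n)\right)>q$; then (i) $\lambda(l(I_n))\geq q$ for all $n\in\mathbb{N}$, and (ii) there exists $n\in\mathbb{N}$ such that $\lambda(l(I_n))=q$.
   Context: A set $F\subset\mathbb{Q}$ is left-finite if $\{x\in F: x\le q\}$ is finite for every $q\in\mathbb{Q}$. The Levi-Civita field $\mathcal{R}$ is the set of functions $x:\mathbb{Q}\to\mathbb{R}$ (values written $x[q]$) whose support $\{q: x[q]\neq 0\}$ is left-finite, with pointwise sum and product $(x\cdot y)[q]=\sum_{q_1+q_2=q}x[q_1]y[q_2]$. For $x\ne 0$, $\lambda(x)=\min\operatorname{supp}(x)$, and $\lambda(0)=\infty$. For $x\neq y$, $x<y$ iff $(x-y)[\lambda(x-y)]<0$. This makes $\mathcal{R}$ an ordered field containing $\mathbb{R}$. A sequence strongly converges to $l$ if for every $\varepsilon\in\mathcal{R}$, $\varepsilon>0$, eventually $|a_n-l|<\varepsilon$; series of lengths are strong limits of partial sums. For $a\le b$ in $\mathcal{R}$, $I(a,b)$ denotes any of the four intervals (open, closed, half-open) of $\mathcal{R}$ with endpoints $a,b$ (degenerate intervals of length $0$ are allowed), with length $l(I(a,b))=b-a$.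 A set $A\subseteq\mathcal{R}$ is measurable iff for every $\varepsilon\in\mathcal{R}$, $\varepsilon>0$, there are two sequences of mutually disjoint intervals $\{I_n\}_{n\in\mathbb{N}}$, $\{J_n\}_{n\in\mathbb{N}}$ such that $\bigcup_n I_n\subseteq A\subseteq\bigcup_n J_n$, $\sum_n l(I_n)$ and $\sum_n l(J_n)$ strongly converge in $\mathcal{R}$, and $\sum_n l(J_n)-\sum_n l(I_n)\le\varepsilon$. The measure $m(A)\in\mathcal{R}$ of a measurable $A$ is the (existing) supremum of $\sum_n l(I_n)$ over sequences of disjoint intervals with $\bigcup_n I_n\subseteq A$ and strongly convergent sum; it equals the infimum of $\sum_n l(J_n)$ over sequences of disjoint intervals with $A\subseteq\bigcup_n J_n$ and strongly convergent sum. *)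

theory Defs
  imports Complex_Main "HOL-Library.Disjoint_Sets" "HOL-Library.Extended"
begin

section \<open>Left-finite sets of rationals\<close>

definition left_finite :: "rat set \<Rightarrow> bool" where
  "left_finite F \<longleftrightarrow> (\<forall>q. finite {x \<in> F. x \<le> q})"

lemma left_finiteD: "left_finite F \<Longrightarrow> finite {x \<in> F. x \<le> q}"
  by (simp add: left_finite_def)

lemma left_finite_subset: "left_finite G \<Longrightarrow> F \<subseteq> G \<Longrightarrow> left_finite F"
  unfolding left_finite_def by (blast intro: finite_subset[of "{x \<in> F. x \<le> q}" "{x \<in> G. x \<le> q}" for q])

lemma left_finite_Un: "left_finite F \<Longrightarrow> left_finite G \<Longrightarrow> left_finite (F \<union> G)"
proof -
  assume "left_finite F" "left_finite G"
  then have "finite ({x \<in> F. x \<le> q} \<union> {x \<in> G. x \<le> q})" for q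
    by (simp add: left_finite_def)
  moreover have "{x \<in> F \<union> G. x \<le> q} = {x \<in> F. x \<le> q} \<union> {x \<in> G. x \<le> q}" for q
    by auto
  ultimately show ?thesis by (simp add: left_finite_def)
qed

lemma left_finite_finite: "finite F \<Longrightarrow> left_finite F"
  by (simp add: left_finite_def)

lemma left_finite_has_min:
  assumes "left_finite F" "q \<in> F"
  obtains m where "m \<in> F" "\<And>x. x \<in> F \<Longrightarrow> m \<le> x"
proof -
  let ?S = "{x \<in> F. x \<le> q}"
  have fin: "finite ?S" and ne: "?S \<noteq> {}"
    using assms by (auto simp: left_finite_def)
  have "Min ?S \<in> ?S" using fin ne by (rule Min_in)
  moreover have "Min ?S \<le> x" if "x \<in> F" for x
  proof (cases "x \<le> q")
    case True
    then show ?thesis using fin that by simp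
  next
    case False
    then show ?thesis using calculation by auto
  qed
  ultimately show ?thesis using that by blast
qed

lemma left_finite_bdd:
  assumes "left_finite F"
  obtains m where "\<And>x. x \<in> F \<Longrightarrow> m \<le> x"
  using left_finite_has_min[OF assms] by metis

lemma left_finite_pairs:
  assumes "left_finite F" "left_finite G"
  shows "finite {(a, b). a \<in> F \<and> b \<in> G \<and> a + b \<le> q}"
proof -
  obtain m where m: "\<And>x. x \<in> F \<Longrightarrow> m \<le> x" using left_finite_bdd[OF assms(1)] by blast
  obtain n where n: "\<And>x. x \<in> G \<Longrightarrow> n \<le> x" using left_finite_bdd[OF assms(2)] by blast
  have "{(a, b). a \<in> F \<and> b \<in> G \<and> a + b \<le> q} \<subseteq> {a \<in> F. a \<le> q - n} \<times> {b \<in> G. b \<le> q - m}"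
  proof safe
    fix a b assume "a \<in> F" "b \<in> G" "a + b \<le> q"
    then show "a \<le> q - n" "b \<le> q - m" using m[of a] n[of b] by linarith+
  qed
  then show ?thesis
    by (rule finite_subset) (use assms in \<open>auto simp: left_finite_def\<close>)
qed

lemma left_finite_plus:
  assumes "left_finite F" "left_finite G"
  shows "left_finite {a + b | a b. a \<in> F \<and> b \<in> G}"
  unfolding left_finite_def
proof
  fix q
  have "{x \<in> {a + b | a b. a \<in> F \<and> b \<in> G}. x \<le> q}
      = (\<lambda>(a, b). a + b) ` {(a, b). a \<in> F \<and> b \<in> G \<and> a + b \<le> q}" by auto
  then show "finite {x \<in> {a + b | a b. a \<in> F \<and> b \<in> G}. x \<le> q}"
    using left_finite_pairs[OF assms, of q] by simp
qed

section \<open>The Levi-Civita field\<close>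

typedef levi_civita = "{x :: rat \<Rightarrow> real. left_finite {q. x q \<noteq> 0}}"
  morphisms lc_nth Abs_levi_civita
  by (rule exI[of _ "\<lambda>_. 0"]) (simp add: left_finite_def)

setup_lifting type_definition_levi_civita

definition lc_supp :: "levi_civita \<Rightarrow> rat set" where
  "lc_supp x = {q. lc_nth x q \<noteq> 0}"

lemma lc_supp_left_finite: "left_finite (lc_supp x)"
  using lc_nth[of x] by (simp add: lc_supp_def)

lemma in_lc_supp: "q \<in> lc_supp x \<longleftrightarrow> lc_nth x q \<noteq> 0"
  by (simp add: lc_supp_def)

lemma lc_eqI: "(\<And>q. lc_nth x q = lc_nth y q) \<Longrightarrow> x = y"
  by (simp add: lc_nth_inject[symmetric] ext)

instantiation levi_civita :: ab_group_add
begin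

lift_definition zero_levi_civita :: levi_civita is "\<lambda>_. 0"
  by (simp add: left_finite_def)

lift_definition plus_levi_civita :: "levi_civita \<Rightarrow> levi_civita \<Rightarrow> levi_civita"
  is "\<lambda>x y q. x q + y q"
  by (erule (1) left_finite_subset[OF left_finite_Un]) auto

lift_definition uminus_levi_civita :: "levi_civita \<Rightarrow> levi_civita" is "\<lambda>x q. - x q"
  by simp

lift_definition minus_levi_civita :: "levi_civita \<Rightarrow> levi_civita \<Rightarrow> levi_civita"
  is "\<lambda>x y q. x q - y q"
  by (erule (1) left_finite_subset[OF left_finite_Un]) auto

instance
  by standard (transfer; simp add: fun_eq_iff)+

end

lemma lc_nth_zero [simp]: "lc_nth 0 q = 0"
  by transfer simp
lemma lc_nth_plus [simp]: "lc_nth (x + y) q = lc_nth x q + lc_nth y q"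
  by transfer simp
lemma lc_nth_uminus [simp]: "lc_nth (- x) q = - lc_nth x q"
  by transfer simp
lemma lc_nth_minus [simp]: "lc_nth (x - y) q = lc_nth x q - lc_nth y q"
  by transfer simp
lemma lc_nth_sum [simp]: "lc_nth (\<Sum>i\<in>A. f i) q = (\<Sum>i\<in>A. lc_nth (f i) q)"
  by (induction A rule: infinite_finite_induct) auto

text \<open>
  The sum in the product is restricted to exponents from the supports, which makes it finite.
\<close>

lemma lc_conv_finite:
  assumes "left_finite {q. x q \<noteq> 0}" "left_finite {q. y q \<noteq> 0}"
  shows "finite {(a, b). a + b = (q :: rat) \<and> x a \<noteq> (0 :: real) \<and> y b \<noteq> (0 :: real)}"
  by (rule finite_subset[OF _ left_finite_pairs[OF assms, of q]]) auto

instantiation levi_civita :: "{one, times}"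
begin

lift_definition one_levi_civita :: levi_civita is "\<lambda>q. if q = 0 then 1 else 0"
  by (simp add: left_finite_finite)

lift_definition times_levi_civita :: "levi_civita \<Rightarrow> levi_civita \<Rightarrow> levi_civita"
  is "\<lambda>x y q. \<Sum>(q1, q2) | q1 + q2 = q \<and> x q1 \<noteq> 0 \<and> y q2 \<noteq> 0. x q1 * y q2"
proof -
  fix x y :: "rat \<Rightarrow> real"
  assume *: "left_finite {q. x q \<noteq> 0}" "left_finite {q. y q \<noteq> 0}"
  show "left_finite {q. (\<Sum>(q1, q2) | q1 + q2 = q \<and> x q1 \<noteq> 0 \<and> y q2 \<noteq> 0. x q1 * y q2) \<noteq> 0}"
    by (rule left_finite_subset[OF left_finite_plus[OF *]])
       (auto elim!: sum.not_neutral_contains_not_neutral)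
qed

instance ..

end

lemma lc_nth_one [simp]: "lc_nth 1 q = (if q = 0 then 1 else 0)"
  by transfer simp

lemma lc_nth_times:
  "lc_nth (x * y) q = (\<Sum>(a, b) | a + b = q \<and> lc_nth x a \<noteq> 0 \<and> lc_nth y b \<noteq> 0. lc_nth x a * lc_nth y b)"
  by transfer simp

lemma lc_nth_times_super:
  assumes "finite A" "\<And>a. lc_nth x a \<noteq> 0 \<Longrightarrow> lc_nth y (q - a) \<noteq> 0 \<Longrightarrow> a \<in> A"
  shows "lc_nth (x * y) q = (\<Sum>a\<in>A. lc_nth x a * lc_nth y (q - a))"
proof -
  have "(\<Sum>a\<in>A. lc_nth x a * lc_nth y (q - a))
      = (\<Sum>a | lc_nth x a \<noteq> 0 \<and> lc_nth y (q - a) \<noteq> 0. lc_nth x a * lc_nth y (q - a))"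
    using assms by (intro sum.mono_neutral_right) auto
  also have "\<dots> = lc_nth (x * y) q"
    unfolding lc_nth_times
    by (rule sum.reindex_bij_witness[of _ fst "\<lambda>a. (a, q - a)"]) auto
  finally show ?thesis ..
qed

lemma lc_conv_finite': "finite {a. lc_nth x a \<noteq> 0 \<and> lc_nth y (q - a) \<noteq> 0}"
proof -
  have "finite {(a, b). a + b = q \<and> lc_nth x a \<noteq> 0 \<and> lc_nth y b \<noteq> 0}"
    using lc_conv_finite lc_nth by blast
  then have "finite (fst ` {(a, b). a + b = q \<and> lc_nth x a \<noteq> 0 \<and> lc_nth y b \<noteq> 0})" by simp
  moreover have "{a. lc_nth x a \<noteq> 0 \<and> lc_nth y (q - a) \<noteq> 0}
      \<subseteq> fst ` {(a, b). a + b = q \<and> lc_nth x a \<noteq> 0 \<and> lc_nth y b \<noteq> 0}"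
    by (force simp: image_iff)
  ultimately show ?thesis by (rule finite_subset[rotated])
qed

lemma lc_times_commute: "x * y = y * (x :: levi_civita)"
proof (rule lc_eqI)
  fix q
  show "lc_nth (x * y) q = lc_nth (y * x) q"
    unfolding lc_nth_times
    by (rule sum.reindex_bij_witness[of _ "\<lambda>(a, b). (b, a)" "\<lambda>(a, b). (b, a)"]) (auto simp: add.commute)
qed

lemma lc_distrib: "(x + y) * z = x * z + y * (z :: levi_civita)"
proof (rule lc_eqI)
  fix q
  let ?A = "{a. lc_nth x a \<noteq> 0 \<and> lc_nth z (q - a) \<noteq> 0} \<union> {a. lc_nth y a \<noteq> 0 \<and> lc_nth z (q - a) \<noteq> 0}"
  have A: "finite ?A" using lc_conv_finite' by blast
  have "lc_nth ((x + y) * z) q = (\<Sum>a\<in>?A. lc_nth (x + y) a * lc_nth z (q - a))"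
    using A by (rule lc_nth_times_super) auto
  also have "\<dots> = (\<Sum>a\<in>?A. lc_nth x a * lc_nth z (q - a)) + (\<Sum>a\<in>?A. lc_nth y a * lc_nth z (q - a))"
    by (simp add: distrib_right sum.distrib)
  also have "(\<Sum>a\<in>?A. lc_nth x a * lc_nth z (q - a)) = lc_nth (x * z) q"
    using A by (rule lc_nth_times_super[symmetric]) auto
  also have "(\<Sum>a\<in>?A. lc_nth y a * lc_nth z (q - a)) = lc_nth (y * z) q"
    using A by (rule lc_nth_times_super[symmetric]) auto
  finally show "lc_nth ((x + y) * z) q = lc_nth (x * z + y * z) q" by simp
qed

lemma lc_supp_times: "lc_supp (x * y) \<subseteq> {a + b | a b. a \<in> lc_supp x \<and> b \<in> lc_supp y}"
  by (auto simp: lc_supp_def lc_nth_times elim!: sum.not_neutral_contains_not_neutral)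

lemma lc_times_assoc_aux:
  "lc_nth ((x * y) * z) q = (\<Sum>(a, b) | lc_nth x a \<noteq> 0 \<and> lc_nth y b \<noteq> 0 \<and> lc_nth z (q - a - b) \<noteq> 0.
     lc_nth x a * lc_nth y b * lc_nth z (q - a - b))"
proof -
  let ?T = "{(a, b). lc_nth x a \<noteq> 0 \<and> lc_nth y b \<noteq> 0 \<and> lc_nth z (q - a - b) \<noteq> 0}"
  let ?f = "\<lambda>(a, b). lc_nth x a * lc_nth y b * lc_nth z (q - a - b)"
  obtain m where m: "\<And>c. c \<in> lc_supp z \<Longrightarrow> m \<le> c"
    using left_finite_bdd[OF lc_supp_left_finite] by blast
  have fT: "finite ?T"
  proof (rule finite_subset[OF _ left_finite_pairs[OF lc_supp_left_finite[of x] lc_supp_left_finite[of y], of "q - m"]])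
    show "?T \<subseteq> {(a, b). a \<in> lc_supp x \<and> b \<in> lc_supp y \<and> a + b \<le> q - m}"
      using m by (force simp: in_lc_supp)
  qed
  let ?P = "(\<lambda>(a, b). a + b) ` ?T"
  have fP: "finite ?P" using fT by simp
  have "lc_nth ((x * y) * z) q = (\<Sum>p\<in>?P. lc_nth (x * y) p * lc_nth z (q - p))"
  proof (rule lc_nth_times_super[OF fP])
    fix p assume p: "lc_nth (x * y) p \<noteq> 0" "lc_nth z (q - p) \<noteq> 0"
    then obtain a b where "p = a + b" "lc_nth x a \<noteq> 0" "lc_nth y b \<noteq> 0"
      using lc_supp_times[of x y] by (auto simp: lc_supp_def)
    then show "p \<in> ?P" using p(2) by (force simp: image_iff diff_diff_eq)
  qed
  also have "\<dots> = (\<Sum>p\<in>?P. \<Sum>t | t \<in> ?T \<and> (\<lambda>(a, b). a + b) t = p. ?f t)"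
  proof (rule sum.cong[OF refl])
    fix p assume p: "p \<in> ?P"
    show "lc_nth (x * y) p * lc_nth z (q - p) = (\<Sum>t | t \<in> ?T \<and> (\<lambda>(a, b). a + b) t = p. ?f t)"
    proof (cases "lc_nth z (q - p) = 0")
      case True
      then have e: "{t. t \<in> ?T \<and> (\<lambda>(a, b). a + b) t = p} = {}"
        by (auto simp: diff_diff_eq)
      show ?thesis unfolding e using True by simp
    next
      case False
      have e: "{t. t \<in> ?T \<and> (\<lambda>(a, b). a + b) t = p} = {(a, b). a + b = p \<and> lc_nth x a \<noteq> 0 \<and> lc_nth y b \<noteq> 0}"
        using False by (auto simp: diff_diff_eq)
      show ?thesis unfolding e lc_nth_times sum_distrib_right
        by (rule sum.cong) (auto simp: diff_diff_eq)
    qed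
  qed
  also have "\<dots> = sum ?f ?T"
    by (rule sum.group[OF fT fP order_refl])
  finally show ?thesis .
qed

lemma lc_times_assoc: "(x * y) * z = x * (y * (z :: levi_civita))"
proof (rule lc_eqI)
  fix q
  have "lc_nth (x * (y * z)) q = lc_nth ((z * y) * x) q"
    by (simp add: lc_times_commute)
  also have "\<dots> = lc_nth ((x * y) * z) q"
    unfolding lc_times_assoc_aux
    by (rule sum.reindex_bij_witness
          [of _ "\<lambda>(a, b). (q - a - b, b)" "\<lambda>(a, b). (q - a - b, b)"])
       (auto simp: algebra_simps)
  finally show "lc_nth ((x * y) * z) q = lc_nth (x * (y * z)) q" ..
qed

instance levi_civita :: comm_ring_1
proof
  fix x y z :: levi_civita
  show "(x * y) * z = x * (y * z)" by (rule lc_times_assoc)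
  show "x * y = y * x" by (rule lc_times_commute)
  show "(x + y) * z = x * z + y * z" by (rule lc_distrib)
  show "1 * x = x"
  proof (rule lc_eqI)
    fix q
    show "lc_nth (1 * x) q = lc_nth x q"
      by (subst lc_nth_times_super[of "{0}"]) (auto split: if_splits)
  qed
  have "lc_nth 0 0 \<noteq> lc_nth 1 0" by simp
  then show "(0 :: levi_civita) \<noteq> 1" by metis
qed

text \<open>For \<^term>\<open>x \<noteq> 0\<close>, \<open>lc_lead x\<close> is the least element of the support of \<^term>\<open>x\<close>.\<close>

definition lc_lead :: "levi_civita \<Rightarrow> rat" where
  "lc_lead x = (LEAST q. q \<in> lc_supp x)"

text \<open>The exponent of \<open>0\<close> is \<open>Pinf\<close>; the value \<open>Minf\<close> of the library type is never taken.\<close>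

definition lc_lambda :: "levi_civita \<Rightarrow> rat extended" where
  "lc_lambda x = (if x = 0 then Pinf else Fin (lc_lead x))"

lemma lc_lead:
  assumes "x \<noteq> 0"
  shows lc_lead_in: "lc_lead x \<in> lc_supp x" and lc_lead_le: "q \<in> lc_supp x \<Longrightarrow> lc_lead x \<le> q"
proof -
  obtain p where "p \<in> lc_supp x"
    using assms by (metis in_lc_supp lc_eqI lc_nth_zero)
  then obtain m where m: "m \<in> lc_supp x" "\<And>q. q \<in> lc_supp x \<Longrightarrow> m \<le> q"
    using left_finite_has_min[OF lc_supp_left_finite] by blast
  then have "lc_lead x = m"
    unfolding lc_lead_def by (intro Least_equality) auto
  then show "lc_lead x \<in> lc_supp x" "q \<in> lc_supp x \<Longrightarrow> lc_lead x \<le> q" using m by auto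
qed

lemma lc_nth_less_lead: "x \<noteq> 0 \<Longrightarrow> q < lc_lead x \<Longrightarrow> lc_nth x q = 0"
  using lc_lead_le[of x q] by (auto simp: in_lc_supp)

lemma lc_nth_lead: "x \<noteq> 0 \<Longrightarrow> lc_nth x (lc_lead x) \<noteq> 0"
  using lc_lead_in by (auto simp: in_lc_supp)

lemma lc_lead_eqI:
  assumes "lc_nth x q \<noteq> 0" "\<And>p. p < q \<Longrightarrow> lc_nth x p = 0"
  shows "lc_lead x = q"
proof -
  have "x \<noteq> 0" using assms(1) by auto
  then show ?thesis
    by (metis assms lc_nth_lead lc_nth_less_lead linorder_neqE)
qed

lemma lc_lead_uminus: "lc_lead (- x) = lc_lead x"
  by (simp add: lc_lead_def lc_supp_def)

subsection \<open>Order\<close>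

instantiation levi_civita :: ord
begin

definition less_levi_civita :: "levi_civita \<Rightarrow> levi_civita \<Rightarrow> bool" where
  "x < y \<longleftrightarrow> x \<noteq> y \<and> lc_nth (x - y) (lc_lead (x - y)) < 0"

definition less_eq_levi_civita :: "levi_civita \<Rightarrow> levi_civita \<Rightarrow> bool" where
  "x \<le> (y :: levi_civita) \<longleftrightarrow> x < y \<or> x = y"

instance ..

end

instantiation levi_civita :: "{abs, sgn}"
begin

definition abs_levi_civita :: "levi_civita \<Rightarrow> levi_civita" where
  "\<bar>x :: levi_civita\<bar> = (if x < 0 then - x else x)"

definition sgn_levi_civita :: "levi_civita \<Rightarrow> levi_civita" where
  "sgn (x :: levi_civita) = (if x = 0 then 0 else if 0 < x then 1 else - 1)"

instance ..

end

lemma lc_less_iff: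
  "x < y \<longleftrightarrow> (\<exists>q. lc_nth x q < lc_nth y q \<and> (\<forall>p<q. lc_nth x p = lc_nth y p))"
proof
  assume l: "x < y"
  then have "x - y \<noteq> 0" by (simp add: less_levi_civita_def)
  then show "\<exists>q. lc_nth x q < lc_nth y q \<and> (\<forall>p<q. lc_nth x p = lc_nth y p)"
    using l lc_nth_less_lead[of "x - y"] by (intro exI[of _ "lc_lead (x - y)"]) (simp add: less_levi_civita_def)
next
  assume "\<exists>q. lc_nth x q < lc_nth y q \<and> (\<forall>p<q. lc_nth x p = lc_nth y p)"
  then obtain q where q: "lc_nth x q < lc_nth y q" "\<And>p. p < q \<Longrightarrow> lc_nth x p = lc_nth y p" by blast
  then have "lc_lead (x - y) = q" by (intro lc_lead_eqI) auto
  then show "x < y" using q by (auto simp: less_levi_civita_def)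
qed

lemma lc_less_trans: "x < y \<Longrightarrow> y < z \<Longrightarrow> x < (z :: levi_civita)"
proof -
  assume "x < y" "y < z"
  then obtain p q where p: "lc_nth x p < lc_nth y p" "\<And>r. r < p \<Longrightarrow> lc_nth x r = lc_nth y r"
    and q: "lc_nth y q < lc_nth z q" "\<And>r. r < q \<Longrightarrow> lc_nth y r = lc_nth z r"
    by (auto simp: lc_less_iff)
  show "x < z"
    unfolding lc_less_iff
  proof (intro exI[of _ "min p q"] conjI allI impI)
    show "lc_nth x (min p q) < lc_nth z (min p q)"
      using p q by (cases p q rule: linorder_cases) (auto simp: min_def)
  qed (use p q in auto)
qed

lemma lc_less_irrefl: "\<not> x < (x :: levi_civita)"
  by (simp add: lc_less_iff)

lemma lc_nth_times_lead:
  assumes "\<And>p. p < a \<Longrightarrow> lc_nth x p = 0" "\<And>p. p < b \<Longrightarrow> lc_nth y p = 0"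
  shows "lc_nth (x * y) (a + b) = lc_nth x a * lc_nth y b"
    and "p < a + b \<Longrightarrow> lc_nth (x * y) p = 0"
proof -
  have "p = a" if "lc_nth x p \<noteq> 0" "lc_nth y (a + b - p) \<noteq> 0" for p
  proof -
    have "\<not> p < a" "\<not> a + b - p < b" using that assms by blast+
    then show ?thesis by simp
  qed
  then show "lc_nth (x * y) (a + b) = lc_nth x a * lc_nth y b"
    by (subst lc_nth_times_super[of "{a}"]) auto
  show "lc_nth (x * y) p = 0" if "p < a + b"
  proof -
    have False if "lc_nth x r \<noteq> 0" "lc_nth y (p - r) \<noteq> 0" for r
    proof -
      have "\<not> r < a" "\<not> p - r < b" using that assms by blast+
      then show ?thesis using \<open>p < a + b\<close> by simp
    qed
    then show ?thesis by (subst lc_nth_times_super[of "{}"]) auto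
  qed
qed

lemma lc_mult_pos: "0 < x \<Longrightarrow> 0 < y \<Longrightarrow> 0 < x * (y :: levi_civita)"
proof -
  assume "0 < x" "0 < y"
  then obtain a b where a: "0 < lc_nth x a" "\<And>r. r < a \<Longrightarrow> lc_nth x r = 0"
    and b: "0 < lc_nth y b" "\<And>r. r < b \<Longrightarrow> lc_nth y r = 0"
    by (fastforce simp: lc_less_iff)
  then have "0 < lc_nth (x * y) (a + b)" "\<And>r. r < a + b \<Longrightarrow> lc_nth (x * y) r = 0"
    using lc_nth_times_lead[of a x b y] by auto
  then show ?thesis by (force simp: lc_less_iff)
qed

lemma lc_less_diff: "x < y \<longleftrightarrow> 0 < y - (x :: levi_civita)"
  by (simp add: lc_less_iff) (metis right_minus_eq)

instance levi_civita :: linordered_idom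
proof
  fix x y z :: levi_civita
  show "x \<le> x" by (simp add: less_eq_levi_civita_def)
  show "(x < y) = (x \<le> y \<and> \<not> y \<le> x)"
    using lc_less_trans[of x y z] lc_less_trans[of x y x] lc_less_irrefl[of x]
    by (auto simp: less_eq_levi_civita_def)
  show "x \<le> y \<Longrightarrow> y \<le> z \<Longrightarrow> x \<le> z" "x \<le> y \<Longrightarrow> y \<le> x \<Longrightarrow> x = y"
    using lc_less_trans[of x y z] lc_less_trans[of x y x] lc_less_irrefl[of x]
    by (auto simp: less_eq_levi_civita_def)
  show "x \<le> y \<or> y \<le> x"
  proof (cases "x = y")
    case False
    then have "x - y \<noteq> 0" by simp
    then have "lc_nth (x - y) (lc_lead (x - y)) \<noteq> 0" by (rule lc_nth_lead)
    moreover have "y - x = - (x - y)" by simp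
    then have "lc_lead (y - x) = lc_lead (x - y)" by (metis lc_lead_uminus)
    ultimately show ?thesis
      using False by (auto simp: less_eq_levi_civita_def less_levi_civita_def)
  qed (simp add: less_eq_levi_civita_def)
  show "x \<le> y \<Longrightarrow> z + x \<le> z + y"
    by (auto simp: less_eq_levi_civita_def lc_less_iff)
  show "x < y \<Longrightarrow> 0 < z \<Longrightarrow> z * x < z * y"
    using lc_mult_pos[of z "y - x"]
    by (simp add: lc_less_diff[of x y] lc_less_diff[of "z * x"] right_diff_distrib)
  show "\<bar>x :: levi_civita\<bar> = (if x < 0 then - x else x)" by (rule abs_levi_civita_def)
  show "sgn x = (if x = 0 then 0 else if 0 < x then 1 else - 1)" by (rule sgn_levi_civita_def)
qed

subsection \<open>Inverses\<close>

lift_definition lc_monom :: "real \<Rightarrow> rat \<Rightarrow> levi_civita" is "\<lambda>c r q. if q = r then c else 0"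
proof (rule left_finite_finite)
  show "finite {q. (if q = r then c else 0) \<noteq> 0}" for c :: real and r :: rat
    by (rule finite_subset[of _ "{r}"]) auto
qed

lemma lc_nth_monom [simp]: "lc_nth (lc_monom c r) q = (if q = r then c else 0)"
  by transfer simp

lemma lc_times_agree:
  assumes "\<And>p. p < 0 \<Longrightarrow> lc_nth x p = 0" "\<And>p. p \<le> q \<Longrightarrow> lc_nth y p = lc_nth z p"
  shows "lc_nth (x * y) q = lc_nth (x * z) q"
proof -
  have eq: "lc_nth y (q - a) = lc_nth z (q - a)" if "lc_nth x a \<noteq> 0" for a
  proof -
    have "\<not> a < 0" using that assms(1) by blast
    then show ?thesis by (intro assms(2)) simp
  qed
  have *: "lc_nth (x * y) q = (\<Sum>a | lc_nth x a \<noteq> 0 \<and> lc_nth y (q - a) \<noteq> 0. lc_nth x a * lc_nth y (q - a))"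
    by (rule lc_nth_times_super[OF lc_conv_finite']) simp
  also have "\<dots> = (\<Sum>a | lc_nth x a \<noteq> 0 \<and> lc_nth z (q - a) \<noteq> 0. lc_nth x a * lc_nth z (q - a))"
  proof (rule sum.cong)
    show "{a. lc_nth x a \<noteq> 0 \<and> lc_nth y (q - a) \<noteq> 0} = {a. lc_nth x a \<noteq> 0 \<and> lc_nth z (q - a) \<noteq> 0}"
      by (rule Collect_cong) (metis eq)
  qed (simp add: eq)
  also have "\<dots> = lc_nth (x * z) q"
    by (rule lc_nth_times_super[OF lc_conv_finite', symmetric]) simp
  finally show ?thesis .
qed

lemma lc_nth_power_less:
  assumes "\<And>p. p < l \<Longrightarrow> lc_nth u p = 0" "p < of_nat n * l"
  shows "lc_nth (u ^ n) p = 0"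
  using assms(2)
proof (induction n arbitrary: p)
  case (Suc n)
  have "lc_nth (u * u ^ n) p = 0"
    using Suc.prems
    by (intro lc_nth_times_lead(2)[of l u "of_nat n * l"] assms(1) Suc.IH) (auto simp: algebra_simps)
  then show ?case by simp
qed simp

lemma lc_geometric:
  assumes u: "\<And>p. p < l \<Longrightarrow> lc_nth u p = 0" and l: "0 < l"
  shows "\<exists>w. (1 - u) * w = 1"
proof -
  define N where "N q = nat \<lceil>q / l\<rceil> + 1" for q
  have N: "q < of_nat n * l" if "N q \<le> n" for q n
  proof -
    have "q / l \<le> of_nat (nat \<lceil>q / l\<rceil>)" by (rule of_nat_ceiling)
    also have "\<dots> < of_nat n"
      using that by (simp only: of_nat_less_iff N_def)
    finally show ?thesis using l by (simp add: divide_simps)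
  qed
  define S where "S n = (\<Sum>i<n. u ^ i)" for n
  have S: "lc_nth (S n) q = lc_nth (S m) q" if "N q \<le> m" "m \<le> n" for m n q
    using that(2)
  proof (induction n rule: dec_induct)
    case (step k)
    have "lc_nth (u ^ k) q = 0"
      using N[of q k] step.hyps that(1) by (intro lc_nth_power_less[OF u]) auto
    then show ?case using step.IH by (simp add: S_def)
  qed simp
  define f where "f q = lc_nth (S (N q)) q" for q
  have N_mono: "N p \<le> N q" if "p \<le> q" for p q
    using l that by (auto simp: N_def divide_right_mono ceiling_mono intro!: nat_mono)
  have f: "f p = lc_nth (S (N q)) p" if "p \<le> q" for p q
    using S[of p "N p" "N q"] N_mono[OF that] by (simp add: f_def)
  have "left_finite {q. f q \<noteq> 0}"
    unfolding left_finite_def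
  proof
    fix q
    have "{x \<in> {q. f q \<noteq> 0}. x \<le> q} \<subseteq> {x \<in> lc_supp (S (N q)). x \<le> q}"
      using f by (auto simp: in_lc_supp)
    then show "finite {x \<in> {q. f q \<noteq> 0}. x \<le> q}"
      using left_finiteD[OF lc_supp_left_finite] by (rule finite_subset)
  qed
  then have w: "lc_nth (Abs_levi_civita f) = f" by (simp add: Abs_levi_civita_inverse)
  have "(1 - u) * Abs_levi_civita f = 1"
  proof (rule lc_eqI)
    fix q
    have "lc_nth ((1 - u) * Abs_levi_civita f) q = lc_nth ((1 - u) * S (N q)) q"
      using u l by (intro lc_times_agree) (auto simp: w f)
    also have "(1 - u) * S (N q) = 1 - u ^ N q"
      by (simp add: S_def one_diff_power_eq)
    also have "lc_nth (1 - u ^ N q) q = lc_nth 1 q"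
      using lc_nth_power_less[OF u, of l q "N q"] N[of q "N q"] by auto
    finally show "lc_nth ((1 - u) * Abs_levi_civita f) q = lc_nth 1 q" .
  qed
  then show ?thesis by blast
qed

lemma lc_inverse_ex:
  assumes "x \<noteq> (0 :: levi_civita)"
  shows "\<exists>y. x * y = 1"
proof -
  let ?q = "lc_lead x"
  define c where "c = lc_nth x ?q"
  have c: "c \<noteq> 0" using lc_nth_lead[OF assms] by (simp add: c_def)
  define m where "m = lc_monom (1 / c) (- ?q)"
  define u where "u = 1 - x * m"
  have *: "lc_nth (x * m) (?q + - ?q) = lc_nth x ?q * lc_nth m (- ?q)"
    by (rule lc_nth_times_lead) (auto simp: m_def lc_nth_less_lead[OF assms])
  have **: "lc_nth (x * m) p = 0" if "p < ?q + - ?q" for p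
    by (rule lc_nth_times_lead(2)[OF _ _ that]) (auto simp: m_def lc_nth_less_lead[OF assms])
  have u0: "lc_nth u p = 0" if "p \<le> 0" for p
    using that * **[of p] c by (cases "p = 0") (auto simp: u_def m_def c_def)
  have "\<exists>w. (1 - u) * w = 1"
  proof (cases "u = 0")
    case True
    then show ?thesis by simp
  next
    case False
    then have "0 < lc_lead u" using u0 lc_nth_lead[OF False] by (meson not_le)
    then show ?thesis using lc_geometric lc_nth_less_lead[OF False] by blast
  qed
  then obtain w where "(1 - u) * w = 1" by blast
  then have "x * (m * w) = 1" by (simp add: u_def mult.assoc)
  then show ?thesis by blast
qed

instantiation levi_civita :: inverse
begin

definition inverse_levi_civita :: "levi_civita \<Rightarrow> levi_civita" where
  "inverse (x :: levi_civita) = (if x = 0 then 0 else THE y. x * y = 1)"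

definition divide_levi_civita :: "levi_civita \<Rightarrow> levi_civita \<Rightarrow> levi_civita" where
  "x div y = x * inverse (y :: levi_civita)"

instance ..

end

instance levi_civita :: linordered_field
proof
  fix x y :: levi_civita
  show "inverse x * x = 1" if x: "x \<noteq> 0"
  proof -
    obtain y where y: "x * y = 1" using lc_inverse_ex[OF x] by blast
    have "(THE y. x * y = 1) = y"
      using y by (rule the_equality) (metis y mult_left_cancel[OF x])
    then have "inverse x = y" using x by (simp add: inverse_levi_civita_def)
    then show ?thesis using y by (simp add: mult.commute)
  qed
qed (auto simp: inverse_levi_civita_def divide_levi_civita_def)

section \<open>Strong convergence\<close>

definition strongly_converges_to :: "(nat \<Rightarrow> levi_civita) \<Rightarrow> levi_civita \<Rightarrow> bool" where
  "strongly_converges_to a l \<longleftrightarrow> (\<forall>\<epsilon>>0. \<forall>\<^sub>F n in sequentially. \<bar>a n - l\<bar> < \<epsilon>)"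

definition strongly_sums :: "(nat \<Rightarrow> levi_civita) \<Rightarrow> levi_civita \<Rightarrow> bool" where
  "strongly_sums f s \<longleftrightarrow> strongly_converges_to (\<lambda>n. \<Sum>i<n. f i) s"

definition strongly_summable :: "(nat \<Rightarrow> levi_civita) \<Rightarrow> bool" where
  "strongly_summable f \<longleftrightarrow> (\<exists>s. strongly_sums f s)"

definition strong_suminf :: "(nat \<Rightarrow> levi_civita) \<Rightarrow> levi_civita" where
  "strong_suminf f = (THE s. strongly_sums f s)"

lemma strongly_converges_to_unique:
  assumes "strongly_converges_to a k" "strongly_converges_to a l"
  shows "k = l"
proof (rule ccontr)
  assume "k \<noteq> l"
  then have "0 < \<bar>k - l\<bar> / 2" by simp
  then have "\<forall>\<^sub>F n in sequentially. \<bar>a n - k\<bar> < \<bar>k - l\<bar> / 2" "\<forall>\<^sub>F n in sequentially. \<bar>a n - l\<bar> < \<bar>k - l\<bar> / 2"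
    using assms unfolding strongly_converges_to_def by blast+
  then have "\<forall>\<^sub>F n in sequentially. False"
  proof eventually_elim
    case (elim n)
    have "\<bar>k - l\<bar> \<le> \<bar>a n - k\<bar> + \<bar>a n - l\<bar>" by (simp add: abs_if)
    also have "\<dots> < \<bar>k - l\<bar> / 2 + \<bar>k - l\<bar> / 2" using elim by (rule add_strict_mono)
    finally show ?case by simp
  qed
  then show False by simp
qed

lemma strong_suminf_eq: "strongly_sums f s \<Longrightarrow> strong_suminf f = s"
  unfolding strong_suminf_def strongly_sums_def
  by (blast intro: strongly_converges_to_unique)

section \<open>Intervals and measure\<close>

definition interval_with_ends :: "levi_civita set \<Rightarrow> levi_civita \<Rightarrow> levi_civita \<Rightarrow> bool" where
  "interval_with_ends I a b \<longleftrightarrow> a \<le> b \<and> I \<in> {{a<..<b}, {a..b}, {a<..b}, {a..<b}}"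

definition lc_interval :: "levi_civita set \<Rightarrow> bool" where
  "lc_interval I \<longleftrightarrow> (\<exists>a b. interval_with_ends I a b)"

text \<open>
  The empty set is an interval with ends \<open>a, a\<close> for every \<open>a\<close>; a nonempty interval
  has unique ends. In both cases the length is well defined.
\<close>

definition lc_length :: "levi_civita set \<Rightarrow> levi_civita" where
  "lc_length I = (THE l. \<exists>a b. interval_with_ends I a b \<and> l = b - a)"

lemma interval_with_ends_mem:
  assumes "interval_with_ends I a b"
  shows "a < x \<Longrightarrow> x < b \<Longrightarrow> x \<in> I" and "x \<in> I \<Longrightarrow> a \<le> x" and "x \<in> I \<Longrightarrow> x \<le> b"
  using assms by (auto simp: interval_with_ends_def)

lemma interval_with_ends_ends_le:
  assumes I: "interval_with_ends I a b" "interval_with_ends I c d" and x: "x \<in> I"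
  shows "c \<le> a" "b \<le> d"
proof -
  have abx: "a \<le> x" "x \<le> b" "c \<le> x" "x \<le> d"
    using interval_with_ends_mem(2,3)[OF I(1) x] interval_with_ends_mem(2,3)[OF I(2) x] by auto
  show "c \<le> a"
  proof (rule ccontr)
    assume "\<not> c \<le> a"
    then obtain z where z: "a < z" "z < c" using dense[of a c] by auto
    then have "z \<in> I" using abx by (intro interval_with_ends_mem(1)[OF I(1)]) auto
    then show False using interval_with_ends_mem(2)[OF I(2)] z by fastforce
  qed
  show "b \<le> d"
  proof (rule ccontr)
    assume "\<not> b \<le> d"
    then obtain z where z: "d < z" "z < b" using dense[of d b] by auto
    then have "z \<in> I" using abx by (intro interval_with_ends_mem(1)[OF I(1)]) auto
    then show False using interval_with_ends_mem(3)[OF I(2)] z by fastforce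
  qed
qed

lemma interval_with_ends_empty: "interval_with_ends {} a b \<Longrightarrow> a = b"
  using interval_with_ends_mem(1)[of "{}" a b] dense[of a b]
  by (force simp: interval_with_ends_def)

lemma lc_length_eq:
  assumes "interval_with_ends I a b"
  shows "lc_length I = b - a"
  unfolding lc_length_def
proof (rule the_equality)
  fix l assume "\<exists>c d. interval_with_ends I c d \<and> l = d - c"
  then obtain c d where cd: "interval_with_ends I c d" "l = d - c" by blast
  show "l = b - a"
  proof (cases "I = {}")
    case True
    then show ?thesis
      using interval_with_ends_empty[of a b] interval_with_ends_empty[of c d] assms cd by simp
  next
    case False
    then obtain x where "x \<in> I" by blast
    then have "a = c" "b = d"
      using interval_with_ends_ends_le assms cd(1) by (meson antisym)+
    then show ?thesis using cd(2) by simp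
  qed
qed (use assms in blast)

definition disjoint_intervals :: "(nat \<Rightarrow> levi_civita set) \<Rightarrow> bool" where
  "disjoint_intervals I \<longleftrightarrow> (\<forall>n. lc_interval (I n)) \<and> disjoint_family I"

definition lc_measurable :: "levi_civita set \<Rightarrow> bool" where
  "lc_measurable A \<longleftrightarrow> (\<forall>\<epsilon>>0. \<exists>I J. disjoint_intervals I \<and> disjoint_intervals J \<and>
     (\<Union>n. I n) \<subseteq> A \<and> A \<subseteq> (\<Union>n. J n) \<and>
     strongly_summable (\<lambda>n. lc_length (I n)) \<and> strongly_summable (\<lambda>n. lc_length (J n)) \<and>
     strong_suminf (\<lambda>n. lc_length (J n)) - strong_suminf (\<lambda>n. lc_length (I n)) \<le> \<epsilon>)"

definition inner_sums :: "levi_civita set \<Rightarrow> levi_civita set" where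
  "inner_sums A = {strong_suminf (\<lambda>n. lc_length (I n)) | I. disjoint_intervals I \<and>
     (\<Union>n. I n) \<subseteq> A \<and> strongly_summable (\<lambda>n. lc_length (I n))}"

definition is_supremum :: "levi_civita set \<Rightarrow> levi_civita \<Rightarrow> bool" where
  "is_supremum S s \<longleftrightarrow> (\<forall>x\<in>S. x \<le> s) \<and> (\<forall>u. (\<forall>x\<in>S. x \<le> u) \<longrightarrow> s \<le> u)"

text \<open>
  Bounded subsets of the Levi-Civita field need not have suprema, so the library's
  \<open>Sup\<close> is not available; for measurable sets the supremum below exists.
\<close>

definition lc_measure :: "levi_civita set \<Rightarrow> levi_civita" where
  "lc_measure A = (THE s. is_supremum (inner_sums A) s)"

end

theory Submission
  imports Defs
begin

text \<open>
  Put \<open>S = (\<Sum>n. l(I\<^sub>n))\<close>. Since \<open>\<lambda>(m(A) - S) > \<lambda>(m(A)) = q\<close>, also \<open>\<lambda>(S) = q\<close>, and from here on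
  \<open>A\<close> plays no role. The lengths are nonnegative, so \<open>0 \<le> l(I\<^sub>n) \<le> S\<close>, and \<open>\<lambda>\<close> reverses the order
  of nonnegative elements; this gives (i). Strong convergence makes each coefficient of the partial
  sums eventually equal to that of \<open>S\<close>; so if all lengths had vanishing coefficient at \<open>q\<close>, the
  same would hold for \<open>S\<close>, which gives (ii).
\<close>

text \<open>Reduces bounds on \<open>lc_lambda\<close> to vanishing coefficients. The case
  \<open>x = 0\<close> fits in because \<open>Pinf\<close> lies above every
  \<open>Fin q\<close>.\<close>

lemma Fin_le_lc_lambda_iff: "Fin q \<le> lc_lambda x \<longleftrightarrow> (\<forall>p<q. lc_nth x p = 0)"
proof (cases "x = 0")
  case False
  have "q \<le> lc_lead x \<longleftrightarrow> (\<forall>p<q. lc_nth x p = 0)"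
    using lc_nth_lead[OF False] lc_nth_less_lead[OF False] less_le_trans
    by (metis not_le)
  then show ?thesis using False by (simp add: lc_lambda_def)
qed (simp add: lc_lambda_def)

lemma lc_lambda_eq_Fin_iff:
  "lc_lambda x = Fin q \<longleftrightarrow> lc_nth x q \<noteq> 0 \<and> (\<forall>p<q. lc_nth x p = 0)"
proof (cases "x = 0")
  case False
  have "lc_lead x = q \<longleftrightarrow> lc_nth x q \<noteq> 0 \<and> (\<forall>p<q. lc_nth x p = 0)"
    using lc_lead_eqI lc_nth_lead[OF False] lc_nth_less_lead[OF False] by metis
  then show ?thesis using False by (simp add: lc_lambda_def)
qed (simp add: lc_lambda_def)

lemma Fin_less_lc_lambda_iff: "Fin q < lc_lambda x \<longleftrightarrow> (\<forall>p\<le>q. lc_nth x p = 0)"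
proof -
  have "Fin q < lc_lambda x \<longleftrightarrow> Fin q \<le> lc_lambda x \<and> lc_lambda x \<noteq> Fin q"
    by (metis order.strict_iff_order)
  also have "\<dots> \<longleftrightarrow> (\<forall>p<q. lc_nth x p = 0) \<and> lc_nth x q = 0"
    by (auto simp only: Fin_le_lc_lambda_iff lc_lambda_eq_Fin_iff)
  also have "\<dots> \<longleftrightarrow> (\<forall>p\<le>q. lc_nth x p = 0)"
    by (metis order.order_iff_strict)
  finally show ?thesis .
qed

lemma lc_lambda_not_Minf: "lc_lambda x \<noteq> Minf"
  by (simp add: lc_lambda_def)

text \<open>Since \<open>x - y\<close> vanishes at all exponents up to and including
  \<open>q\<close>, \<open>x\<close> and \<open>y\<close> have the same coefficients there.\<close>

lemma lc_lambda_eqI_diff: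
  assumes "lc_lambda x = Fin q" "Fin q < lc_lambda (x - y)"
  shows "lc_lambda y = Fin q"
  using assms by (simp add: lc_lambda_eq_Fin_iff Fin_less_lc_lambda_iff)

text \<open>If \<open>y\<close> vanished up to and including the leading exponent \<open>a\<close>
  of \<open>x\<close>, then \<open>y\<close> and \<open>x\<close> would first differ at
  \<open>a\<close>, where \<open>x\<close> has a positive coefficient, so
  \<open>y < x\<close>.\<close>

lemma lc_lambda_antimono:
  assumes "0 \<le> x" "x \<le> y"
  shows "lc_lambda y \<le> lc_lambda x"
proof (cases "x = 0")
  case False
  obtain a where a: "0 < lc_nth x a" "\<And>p. p < a \<Longrightarrow> lc_nth x p = 0"
    using False assms(1) lc_less_iff[of 0 x] by (auto simp: order.order_iff_strict)
  then have "lc_lambda x = Fin a" by (simp add: lc_lambda_eq_Fin_iff)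
  moreover have "\<not> Fin a < lc_lambda y"
  proof
    assume "Fin a < lc_lambda y"
    then have "y < x"
      using a by (auto simp: lc_less_iff Fin_less_lc_lambda_iff intro!: exI[of _ a])
    then show False using assms(2) by simp
  qed
  ultimately show ?thesis by simp
qed (simp add: lc_lambda_def)

lemma lc_lambda_abs: "lc_lambda \<bar>x\<bar> = lc_lambda x"
  by (simp add: abs_if lc_lambda_def lc_lead_uminus)

lemma strongly_converges_to_eventually_lc_nth:
  assumes "strongly_converges_to a l"
  shows "\<forall>\<^sub>F n in sequentially. lc_nth (a n) q = lc_nth l q"
proof -
  \<comment> \<open>An element smaller in absolute value than this monomial has no coefficients
    below \<open>q + 1\<close>, in particular none at \<open>q\<close>.\<close>
  let ?\<epsilon> = "lc_monom 1 (q + 1)"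
  have "0 < ?\<epsilon>" by (auto simp: lc_less_iff intro!: exI[of _ "q + 1"])
  then have "\<forall>\<^sub>F n in sequentially. \<bar>a n - l\<bar> < ?\<epsilon>"
    using assms by (simp add: strongly_converges_to_def)
  then show ?thesis
  proof eventually_elim
    case (elim n)
    then have "lc_lambda ?\<epsilon> \<le> lc_lambda \<bar>a n - l\<bar>" by (intro lc_lambda_antimono) auto
    moreover have "lc_lambda ?\<epsilon> = Fin (q + 1)" by (simp add: lc_lambda_eq_Fin_iff)
    ultimately have "Fin (q + 1) \<le> lc_lambda (a n - l)" by (simp only: lc_lambda_abs)
    then show ?case by (simp add: Fin_le_lc_lambda_iff)
  qed
qed

text \<open>Partial sums that include \<open>f k\<close> are at least \<open>f k\<close>; if
  \<open>s < f k\<close>, they would never come closer to \<open>s\<close> than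
  \<open>f k - s\<close>.\<close>

lemma strongly_sums_ge_term:
  assumes "strongly_sums f s" "\<And>i. 0 \<le> f i"
  shows "f k \<le> s"
proof (rule ccontr)
  assume "\<not> f k \<le> s"
  then have "\<forall>\<^sub>F n in sequentially. \<bar>(\<Sum>i<n. f i) - s\<bar> < f k - s"
    using assms(1) by (simp add: strongly_sums_def strongly_converges_to_def)
  moreover have "\<forall>\<^sub>F n in sequentially. k < n" by (rule eventually_gt_at_top)
  ultimately have "\<forall>\<^sub>F n in sequentially. False"
  proof eventually_elim
    case (elim n)
    have "f k \<le> (\<Sum>i<n. f i)"
      using elim(2) assms(2) by (intro member_le_sum) auto
    moreover have "(\<Sum>i<n. f i) - s < f k - s"
      using elim(1) by (rule le_less_trans[OF abs_ge_self])
    ultimately show ?case by simp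
  qed
  then show False by simp
qed

lemma lc_length_nonneg:
  assumes "lc_interval I"
  shows "0 \<le> lc_length I"
  using assms by (auto simp: lc_interval_def lc_length_eq) (auto simp: interval_with_ends_def)

theorem lemma3p9:
  fixes A :: "levi_civita set" and I :: "nat \<Rightarrow> levi_civita set" and q :: "rat extended"
  assumes "lc_measurable A"
    and "lc_lambda (lc_measure A) = q"
    and "disjoint_intervals I"
    and "(\<Union>n. I n) \<subseteq> A"
    and "strongly_summable (\<lambda>n. lc_length (I n))"
    and "lc_lambda (lc_measure A - strong_suminf (\<lambda>n. lc_length (I n))) > q"
  shows "(\<forall>n. lc_lambda (lc_length (I n)) \<ge> q) \<and> (\<exists>n. lc_lambda (lc_length (I n)) = q)"
proof -
  let ?f = "\<lambda>n. lc_length (I n)"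
  obtain S where S: "strongly_sums ?f S" using assms(5) by (auto simp: strongly_summable_def)
  \<comment> \<open>Nothing lies strictly above \<open>Pinf\<close>, and \<open>Minf\<close> is not
    a value of \<open>lc_lambda\<close>, so \<open>q\<close> is a rational exponent.\<close>
  obtain r where r: "q = Fin r"
    using assms(2,6) lc_lambda_not_Minf by (cases q) auto
  have lamS: "lc_lambda S = Fin r"
    using assms(2,6) unfolding r strong_suminf_eq[OF S] by (rule lc_lambda_eqI_diff)
  have nonneg: "0 \<le> ?f n" for n
    using assms(3) by (intro lc_length_nonneg) (simp add: disjoint_intervals_def)
  have ge: "Fin r \<le> lc_lambda (?f n)" for n
    using lc_lambda_antimono[OF nonneg strongly_sums_ge_term[OF S nonneg]] lamS by simp
  have "\<exists>n. lc_lambda (?f n) = Fin r"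
  proof (rule ccontr)
    assume "\<nexists>n. lc_lambda (?f n) = Fin r"
    then have zero: "lc_nth (?f n) r = 0" for n
      using ge[of n] by (auto simp: lc_lambda_eq_Fin_iff Fin_le_lc_lambda_iff)
    have "\<forall>\<^sub>F n in sequentially. lc_nth (\<Sum>i<n. ?f i) r = lc_nth S r"
      using S unfolding strongly_sums_def by (rule strongly_converges_to_eventually_lc_nth)
    \<comment> \<open>The partial sums all vanish at \<open>r\<close>, so the eventual equation no
      longer depends on \<open>n\<close> and holds outright.\<close>
    then have "lc_nth S r = 0" by (simp add: zero)
    then show False using lamS by (simp add: lc_lambda_eq_Fin_iff)
  qed
  then show ?thesis using ge r by simp
qed

end
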